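(* Assume $1/L<\lambda_g$ and let $\{x^k\}_{k=0}^\infty$ be a sequence of iterates generated by the anisotropic proximal gradient method with step-size $\lambda=1/L$. Let $F=f+g$ satisfy the anisotropic proximal gradient dominance condition relative to $\phi$ with constant $0<\mu<L$ for parameter $1/L$. Then $\{F(x^k)\}_{k=0}^\infty$ converges $Q$-linearly to $\inf F$ with rate $1-\tfrac{\mu}{L}$; in particular, for all $k\ge0$ $$F(x^{k+1})-\inf F\le\big(1-\tfrac{\mu}{L}\big)\big(F(x^k)-\inf F\big).$$
   Context: Reference function: $\phi:\mathbb{R}^n\to\mathbb{R}$ is convex with full domain and Legendre (essentially smooth and essentially strictly convex in the sense of Rockafellar); so $\nabla\phi:\mathbb{R}^n\to\operatorname{int}\operatorname{dom}\phi^*$ is a bijection with inverse $\nabla\phi^*$ ($\phi^*$ the convex conjugate). For $\lambda>0$, $(\lambda\star\phi)(x)=\lambda\phi(\lambda^{-1}x)$. Anisotropic descent property of $f\in\mathcal{C}^1(\mathbb{R}^n)$ relative to $\phi$ with constant $L>0$: $\operatorname{rge}\nabla f\subseteq\operatorname{rge}\nabla\phi$ (rge = range) and for all $\bar x,x\in\mathbb{R}^n$ $$f(x)\le f(\bar x)+\tfrac1L\star\phi\big(x-\bar x+L^{-1}\nabla\phi^*(\nabla f(\bar x))\big)-\tfrac1L\star\phi\big(L^{-1}\nabla\phi^*(\nabla f(\bar x))\big).$$ Problem: minimize $F:=f+g$, where $f\in\mathcal{C}^1(\mathbb{R}^n)$ has the anisotropic descent property relative to $\phi$ with constant $L>0$,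 $g:\mathbb{R}^n\to\overline{\mathbb{R}}$ is proper lower semicontinuous, and $\inf F>-\infty$. Define $\lambda_g:=\sup\{\lambda>0: g+\lambda\star\phi(\cdot-y)\text{ is level-bounded for every }y\in\mathbb{R}^n\}$ (level-bounded: all sublevel sets are bounded); assume $\lambda_g>0$. Anisotropic proximal gradient method with step-size $\lambda$: starting from $x^0\in\mathbb{R}^n$, for $k=0,1,\ldots$ $$y^k=x^k-\lambda\nabla\phi^*(\nabla f(x^k)),\qquad x^{k+1}\in\operatorname*{arg\,min}_{x\in\mathbb{R}^n}\{g(x)+\lambda\star\phi(x-y^k)\}.$$ Regularized gap: for $0<\lambda<\lambda_g$, $\mathcal{G}_F^\phi(\bar x,\lambda):=\tfrac1\lambda\big(F(\bar x)-F_\lambda(\bar x)\big)$, where $$F_\lambda(\bar x):=\inf_{x\in\mathbb{R}^n}\Big\{f(\bar x)+\lambda\star\phi\big(x-\bar x+\lambda\nabla\phi^*(\nabla f(\bar x))\big)-\lambda\star\phi\big(\lambda\nabla\phi^*(\nabla f(\bar x))\big)+g(x)\Big\}.$$ Anisotropic proximal gradient dominance condition relative to $\phi$ with constant $\mu>0$ for parameter $0<\lambda\le\min\{\mu^{-1},\lambda_g\}$: $\mu(F(\bar x)-\inf F)\le\mathcal{G}_F^\phi(\bar x,\lambda)$ for all $\bar x\in\mathbb{R}^n$. A sequence $\{a_k\}$ converges $Q$-linearly to $a$ with rate $\rho$ if $\lim_{k\to\infty}\frac{|a_{k+1}-a|}{|a_k-a|}\le\rho$.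
   Formalization: In the definition of Q-linear convergence the limit of the ratios is replaced by the limit superior (0/0 counted as 0), with convergence to inf F stated explicitly, since the limit of the ratios need not exist. *)

theory Defs
  imports "HOL-Analysis.Analysis"
begin

section \<open>Convex analysis\<close>

definition gradient :: "('a::euclidean_space \<Rightarrow> real) \<Rightarrow> 'a \<Rightarrow> 'a" where
  "gradient f x = (THE D. GDERIV f x :> D)"

definition C1_function :: "('a::euclidean_space \<Rightarrow> real) \<Rightarrow> bool" where
  "C1_function f \<longleftrightarrow> (\<forall>x. f differentiable (at x)) \<and> continuous_on UNIV (gradient f)"

definition eff_domain :: "('a \<Rightarrow> ereal) \<Rightarrow> 'a set" where
  "eff_domain h = {x. h x < \<infinity>}"

definition proper_function :: "('a \<Rightarrow> ereal) \<Rightarrow> bool" where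
  "proper_function h \<longleftrightarrow> (\<forall>x. h x \<noteq> -\<infinity>) \<and> (\<exists>x. h x \<noteq> \<infinity>)"

definition lsc_function :: "('a::topological_space \<Rightarrow> ereal) \<Rightarrow> bool" where
  "lsc_function h \<longleftrightarrow> (\<forall>x. h x \<le> Liminf (at x) h)"

definition level_bounded :: "('a::metric_space \<Rightarrow> ereal) \<Rightarrow> bool" where
  "level_bounded h \<longleftrightarrow> (\<forall>\<alpha>::real. bounded {x. h x \<le> ereal \<alpha>})"

definition subdifferential :: "('a::euclidean_space \<Rightarrow> ereal) \<Rightarrow> 'a \<Rightarrow> 'a set" where
  "subdifferential h x = {v. \<forall>y. h x + ereal (v \<bullet> (y - x)) \<le> h y}"

text \<open>Rockafellar's notions, for a proper convex extended-real-valued function; they are applied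
  below to functions with full domain.\<close>

definition essentially_smooth :: "('a::euclidean_space \<Rightarrow> ereal) \<Rightarrow> bool" where
  "essentially_smooth h \<longleftrightarrow>
     (let C = interior (eff_domain h); r = (\<lambda>x. real_of_ereal (h x)) in
        C \<noteq> {} \<and>
        (\<forall>x\<in>C. r differentiable (at x)) \<and>
        (\<forall>X x. (\<forall>i::nat. X i \<in> C) \<and> x \<in> frontier C \<and> X \<longlonglongrightarrow> x \<longrightarrow>
           filterlim (\<lambda>i. norm (gradient r (X i))) at_top sequentially))"

definition essentially_strictly_convex :: "('a::euclidean_space \<Rightarrow> ereal) \<Rightarrow> bool" where
  "essentially_strictly_convex h \<longleftrightarrow>
     (\<forall>S. convex S \<and> S \<subseteq> {x. subdifferential h x \<noteq> {}} \<longrightarrow>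
        (\<forall>x\<in>S. \<forall>y\<in>S. \<forall>t::real. x \<noteq> y \<and> 0 < t \<and> t < 1 \<longrightarrow>
           h ((1 - t) *\<^sub>R x + t *\<^sub>R y) < ereal (1 - t) * h x + ereal t * h y))"

definition legendre :: "('a::euclidean_space \<Rightarrow> ereal) \<Rightarrow> bool" where
  "legendre h \<longleftrightarrow> essentially_smooth h \<and> essentially_strictly_convex h"

definition convex_conjugate :: "('a::euclidean_space \<Rightarrow> real) \<Rightarrow> 'a \<Rightarrow> ereal" where
  "convex_conjugate \<phi> v = (SUP x. ereal (v \<bullet> x - \<phi> x))"

text \<open>The gradient of the conjugate. It is only meaningful on the interior of the domain of the
  conjugate, where the conjugate is finite and the conversion to the reals loses nothing.\<close>

definition conj_gradient :: "('a::euclidean_space \<Rightarrow> real) \<Rightarrow> 'a \<Rightarrow> 'a" where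
  "conj_gradient \<phi> = gradient (\<lambda>v. real_of_ereal (convex_conjugate \<phi> v))"

definition episcale :: "real \<Rightarrow> ('a::real_vector \<Rightarrow> real) \<Rightarrow> 'a \<Rightarrow> real" where
  "episcale \<tau> \<phi> x = \<tau> * \<phi> ((1 / \<tau>) *\<^sub>R x)"

section \<open>The anisotropic proximal gradient method\<close>

definition anisotropic_descent ::
  "('a::euclidean_space \<Rightarrow> real) \<Rightarrow> ('a \<Rightarrow> real) \<Rightarrow> real \<Rightarrow> bool" where
  "anisotropic_descent \<phi> f L \<longleftrightarrow>
     range (gradient f) \<subseteq> range (gradient \<phi>) \<and>
     (\<forall>xb x. f x \<le> f xb
        + episcale (1 / L) \<phi> (x - xb + (1 / L) *\<^sub>R conj_gradient \<phi> (gradient f xb))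
        - episcale (1 / L) \<phi> ((1 / L) *\<^sub>R conj_gradient \<phi> (gradient f xb)))"

definition objective :: "('a \<Rightarrow> real) \<Rightarrow> ('a \<Rightarrow> ereal) \<Rightarrow> 'a \<Rightarrow> ereal" where
  "objective f g x = ereal (f x) + g x"

text \<open>The threshold \<open>\<lambda>\<^sub>g\<close>, possibly infinite. The supremum of the empty set is \<open>-\<infinity>\<close>.\<close>

definition prox_threshold ::
  "('a::euclidean_space \<Rightarrow> real) \<Rightarrow> ('a \<Rightarrow> ereal) \<Rightarrow> ereal" where
  "prox_threshold \<phi> g =
     Sup {ereal \<tau> | \<tau>. 0 < \<tau> \<and>
            (\<forall>y. level_bounded (\<lambda>x. g x + ereal (episcale \<tau> \<phi> (x - y))))}"

definition apg_iterates ::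
  "('a::euclidean_space \<Rightarrow> real) \<Rightarrow> ('a \<Rightarrow> real) \<Rightarrow> ('a \<Rightarrow> ereal) \<Rightarrow> real \<Rightarrow> (nat \<Rightarrow> 'a) \<Rightarrow> bool" where
  "apg_iterates \<phi> f g \<tau> x \<longleftrightarrow>
     (\<forall>k. let y = x k - \<tau> *\<^sub>R conj_gradient \<phi> (gradient f (x k)) in
        is_arg_min (\<lambda>z. g z + ereal (episcale \<tau> \<phi> (z - y))) (\<lambda>_. True) (x (Suc k)))"

text \<open>The function written \<open>F\<^sub>\<lambda>\<close> in the definition of the regularized gap.\<close>

definition forward_backward_envelope ::
  "('a::euclidean_space \<Rightarrow> real) \<Rightarrow> ('a \<Rightarrow> real) \<Rightarrow> ('a \<Rightarrow> ereal) \<Rightarrow> real \<Rightarrow> 'a \<Rightarrow> ereal" where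
  "forward_backward_envelope \<phi> f g \<tau> xb =
     (INF x. ereal (f xb
        + episcale \<tau> \<phi> (x - xb + \<tau> *\<^sub>R conj_gradient \<phi> (gradient f xb))
        - episcale \<tau> \<phi> (\<tau> *\<^sub>R conj_gradient \<phi> (gradient f xb))) + g x)"

definition regularized_gap ::
  "('a::euclidean_space \<Rightarrow> real) \<Rightarrow> ('a \<Rightarrow> real) \<Rightarrow> ('a \<Rightarrow> ereal) \<Rightarrow> 'a \<Rightarrow> real \<Rightarrow> ereal" where
  "regularized_gap \<phi> f g xb \<tau> =
     ereal (1 / \<tau>) * (objective f g xb - forward_backward_envelope \<phi> f g \<tau> xb)"

definition apg_dominance ::
  "('a::euclidean_space \<Rightarrow> real) \<Rightarrow> ('a \<Rightarrow> real) \<Rightarrow> ('a \<Rightarrow> ereal) \<Rightarrow> real \<Rightarrow> real \<Rightarrow> bool" where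
  "apg_dominance \<phi> f g \<mu> \<tau> \<longleftrightarrow>
     0 < \<mu> \<and> 0 < \<tau> \<and> ereal \<tau> \<le> min (ereal (1 / \<mu>)) (prox_threshold \<phi> g) \<and>
     (\<forall>xb. ereal \<mu> * (objective f g xb - (INF x. objective f g x)) \<le> regularized_gap \<phi> f g xb \<tau>)"

text \<open>The bound on the quotients is imposed on their limit superior, as their limit need not exist.
  In the extended reals \<open>0 / 0 = 0\<close> and \<open>c / 0 = \<infinity>\<close> for \<open>c > 0\<close>, so a sequence that has reached
  its limit causes no problem, and one that leaves it again infinitely often is excluded.\<close>

definition q_linearly_converges :: "(nat \<Rightarrow> ereal) \<Rightarrow> ereal \<Rightarrow> real \<Rightarrow> bool" where
  "q_linearly_converges a l \<rho> \<longleftrightarrow>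
     a \<longlonglongrightarrow> l \<and> limsup (\<lambda>k. \<bar>a (Suc k) - l\<bar> / \<bar>a k - l\<bar>) \<le> ereal \<rho>"

end

theory Submission
  imports Defs
begin

text \<open>
  The descent property says that the model minimised in a step majorises \<open>F = f + g\<close>. Minimising
  \<open>z \<mapsto> g z + \<tau> \<star> \<phi> (z - y\<^sup>k)\<close> is minimising that model, because the two differ by a constant, so the
  minimal value of the model is the envelope \<open>F\<^sub>\<tau>\<close> at the current point. Hence a step satisfies
  \<open>F x\<^sup>k\<^sup>+\<^sup>1 \<le> F\<^sub>\<tau> x\<^sup>k\<close> (lemma \<open>objective_step_le_envelope\<close>): it decreases \<open>F\<close> by at least
  \<open>\<tau>\<close> times the regularized gap. The dominance condition bounds the gap below by \<open>\<mu>\<close> times the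
  suboptimality \<open>F x\<^sup>k - inf F\<close>, so the suboptimality shrinks by the factor \<open>1 - \<mu> \<tau>\<close> in each step
  (lemma \<open>suboptimality_contraction\<close>).

  Everything takes place in the extended reals. Only the starting point can have an infinite
  objective value, because a minimiser of a proper function has a finite value; from the first step
  on the argument is about a geometrically decaying sequence of real numbers (lemma
  \<open>q_linearly_convergesI\<close>).
\<close>

lemma objective_Inf_finite:
  assumes "proper_function g" and "(INF z. objective f g z) > -\<infinity>"
  obtains m where "(INF z. objective f g z) = ereal m"
proof -
  obtain z where "g z \<noteq> \<infinity>"
    using assms(1) unfolding proper_function_def by blast
  then have "objective f g z < \<infinity>"
    by (auto simp: objective_def)
  then have "(INF z. objective f g z) < \<infinity>"
    by (meson INF_lower UNIV_I order_le_less_trans)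
  then show thesis
    using assms(2) that by (cases "INF z. objective f g z") auto
qed

text \<open>The minimiser \<open>x'\<close> of the model attains the infimum that defines the envelope, and the descent
  property bounds \<open>F x'\<close> by the value of the model there.\<close>

lemma objective_step_le_envelope:
  assumes descent: "anisotropic_descent \<phi> f L"
    and proper: "proper_function g"
    and step: "is_arg_min (\<lambda>z. g z + ereal (episcale (1 / L) \<phi>
        (z - (xb - (1 / L) *\<^sub>R conj_gradient \<phi> (gradient f xb))))) (\<lambda>_. True) x'"
  shows "objective f g x' \<le> forward_backward_envelope \<phi> f g (1 / L) xb"
    and "objective f g x' < \<infinity>"
proof -
  define v where "v = (1 / L) *\<^sub>R conj_gradient \<phi> (gradient f xb)"
  define E where "E = (\<lambda>z. episcale (1 / L) \<phi> (z - xb + v))"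
  define c where "c = episcale (1 / L) \<phi> v"
  have least: "g x' + ereal (E x') \<le> g z + ereal (E z)" for z
    using step unfolding is_arg_min_def E_def v_def
    by (auto simp: not_less algebra_simps)
  have majorised: "f x' \<le> f xb + E x' - c"
    using descent unfolding anisotropic_descent_def E_def c_def v_def by blast
  have not_minf: "g z \<noteq> -\<infinity>" for z
    using proper unfolding proper_function_def by blast
  have "objective f g x' \<le> ereal (f xb + E z - c) + g z" for z
    using least[of z] majorised not_minf[of z] not_minf[of x']
    by (cases "g z"; cases "g x'") (auto simp: objective_def)
  then show "objective f g x' \<le> forward_backward_envelope \<phi> f g (1 / L) xb"
    unfolding forward_backward_envelope_def E_def c_def v_def by (intro INF_greatest) auto
  obtain w where "g w \<noteq> \<infinity>"
    using proper unfolding proper_function_def by blast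
  then show "objective f g x' < \<infinity>"
    using least[of w] by (cases "g x'"; cases "g w") (auto simp: objective_def)
qed

text \<open>With \<open>\<tau> = 1 / L\<close> the dominance condition reads \<open>\<mu> (F x - inf F) \<le> L (F x - F\<^sub>\<tau> x)\<close>; replacing
  \<open>F\<^sub>\<tau> x\<close> by the smaller \<open>F x'\<close> and solving for \<open>F x' - inf F\<close> gives the contraction. If \<open>F x\<close> is
  infinite, the right-hand side of the contraction is infinite because \<open>\<mu> < L\<close>.\<close>

lemma suboptimality_contraction:
  assumes "L > 0" and "\<mu> < L"
    and dominance: "apg_dominance \<phi> f g \<mu> (1 / L)"
    and Inf: "(INF z. objective f g z) = ereal m"
    and step: "objective f g x' \<le> forward_backward_envelope \<phi> f g (1 / L) xb"
    and finite: "objective f g x' < \<infinity>"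
  shows "objective f g x' - ereal m \<le> ereal (1 - \<mu> / L) * (objective f g xb - ereal m)"
proof -
  have lower: "ereal m \<le> objective f g z" for z
    unfolding Inf[symmetric] by (rule INF_lower) simp
  obtain r' where r': "objective f g x' = ereal r'"
    using lower[of x'] finite by (cases "objective f g x'") auto
  show ?thesis
  proof (cases "objective f g xb = \<infinity>")
    case True
    then show ?thesis
      using assms(1,2) by (simp add: field_simps)
  next
    case False
    then obtain r where r: "objective f g xb = ereal r"
      using lower[of xb] by (cases "objective f g xb") auto
    have "ereal \<mu> * (ereal r - ereal m)
        \<le> ereal L * (ereal r - forward_backward_envelope \<phi> f g (1 / L) xb)"
      using dominance r Inf unfolding apg_dominance_def regularized_gap_def
      by (auto dest: spec[of _ xb])
    also have "\<dots> \<le> ereal L * (ereal r - ereal r')"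
      using step r' \<open>L > 0\<close> by (intro ereal_mult_left_mono ereal_minus_mono) auto
    finally have "\<mu> * (r - m) \<le> L * (r - r')"
      by simp
    then have "r' - m \<le> (1 - \<mu> / L) * (r - m)"
      using \<open>L > 0\<close> by (simp add: field_simps)
    then show ?thesis
      using r r' by simp
  qed
qed

text \<open>A sequence above \<open>l\<close> whose distance to \<open>l\<close> contracts by \<open>\<rho>\<close> decays geometrically as soon as it
  is finite. A vanishing distance stays zero, so the quotient is then \<open>0 / 0 = 0\<close> and respects the
  bound as well.\<close>

lemma q_linearly_convergesI:
  fixes a :: "nat \<Rightarrow> ereal" and l \<rho> :: real
  assumes \<rho>: "0 \<le> \<rho>" "\<rho> < 1"
    and lower: "\<And>k. ereal l \<le> a k"
    and finite: "\<And>k. a (Suc k) < \<infinity>"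
    and contraction: "\<And>k. a (Suc k) - ereal l \<le> ereal \<rho> * (a k - ereal l)"
  shows "q_linearly_converges a (ereal l) \<rho>"
proof -
  define d where "d = (\<lambda>k. real_of_ereal (a (Suc k)) - l)"
  have a_Suc: "a (Suc k) = ereal (l + d k)" for k
    using lower[of "Suc k"] finite[of k] by (cases "a (Suc k)") (auto simp: d_def)
  have d_nonneg: "0 \<le> d k" for k
    using lower[of "Suc k"] by (simp add: a_Suc)
  have d_step: "d (Suc k) \<le> \<rho> * d k" for k
    using contraction[of "Suc k"] by (simp add: a_Suc)
  have d_decay: "d k \<le> \<rho> ^ k * d 0" for k
  proof (induction k)
    case (Suc k)
    have "d (Suc k) \<le> \<rho> * d k"
      by (rule d_step)
    also have "\<dots> \<le> \<rho> * (\<rho> ^ k * d 0)"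
      using Suc \<rho>(1) by (rule mult_left_mono)
    finally show ?case
      by (simp add: mult_ac)
  qed simp
  have geometric: "(\<lambda>k. \<rho> ^ k * d 0) \<longlonglongrightarrow> 0"
    using \<rho> by (intro tendsto_mult_left_zero LIMSEQ_power_zero) auto
  have "d \<longlonglongrightarrow> 0"
    by (rule tendsto_sandwich[OF _ _ tendsto_const geometric]) (auto simp: d_nonneg d_decay)
  then have "(\<lambda>k. l + d k) \<longlonglongrightarrow> l + 0"
    by (intro tendsto_intros)
  then have "(\<lambda>k. a (Suc k)) \<longlonglongrightarrow> ereal l"
    by (simp add: a_Suc)
  then have limit: "a \<longlonglongrightarrow> ereal l"
    by (rule LIMSEQ_imp_Suc)
  have quotient: "\<bar>a (Suc (Suc k)) - ereal l\<bar> / \<bar>a (Suc k) - ereal l\<bar> \<le> ereal \<rho>" for k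
  proof (cases "d k = 0")
    case True
    then have "d (Suc k) = 0"
      using d_step[of k] d_nonneg[of "Suc k"] by simp
    then show ?thesis
      using True \<rho>(1) by (simp add: a_Suc zero_ereal_def[symmetric])
  next
    case False
    then have "d k > 0"
      using d_nonneg[of k] by simp
    then show ?thesis
      using d_step[of k] d_nonneg[of "Suc k"] by (simp add: a_Suc divide_le_eq)
  qed
  have "\<forall>\<^sub>F k in sequentially. \<bar>a (Suc k) - ereal l\<bar> / \<bar>a k - ereal l\<bar> \<le> ereal \<rho>"
    unfolding eventually_sequentially
  proof (intro exI allI impI)
    fix k :: nat
    assume "1 \<le> k"
    then obtain j where "k = Suc j"
      by (cases k) auto
    then show "\<bar>a (Suc k) - ereal l\<bar> / \<bar>a k - ereal l\<bar> \<le> ereal \<rho>"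
      using quotient by simp
  qed
  then have "limsup (\<lambda>k. \<bar>a (Suc k) - ereal l\<bar> / \<bar>a k - ereal l\<bar>) \<le> ereal \<rho>"
    by (rule Limsup_bounded)
  with limit show ?thesis
    unfolding q_linearly_converges_def by blast
qed

theorem theorem5p7:
  fixes \<phi> f :: "real ^ 'n \<Rightarrow> real"
    and g :: "real ^ 'n \<Rightarrow> ereal"
    and L \<mu> :: real
    and x :: "nat \<Rightarrow> real ^ 'n"
  assumes "convex_on UNIV \<phi>"
    and "legendre (\<lambda>z. ereal (\<phi> z))"
    and "C1_function f"
    and "L > 0"
    and "anisotropic_descent \<phi> f L"
    and "proper_function g"
    and "lsc_function g"
    and "(INF z. objective f g z) > -\<infinity>"
    and "prox_threshold \<phi> g > 0"
    and "ereal (1 / L) < prox_threshold \<phi> g"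
    and "apg_iterates \<phi> f g (1 / L) x"
    and "0 < \<mu>" and "\<mu> < L"
    and "apg_dominance \<phi> f g \<mu> (1 / L)"
  shows "q_linearly_converges (\<lambda>k. objective f g (x k)) (INF z. objective f g z) (1 - \<mu> / L)
     \<and> (\<forall>k. objective f g (x (Suc k)) - (INF z. objective f g z)
            \<le> ereal (1 - \<mu> / L) * (objective f g (x k) - (INF z. objective f g z)))"
proof -
  obtain m where Inf: "(INF z. objective f g z) = ereal m"
    using objective_Inf_finite assms(6,8) by blast
  have step: "is_arg_min (\<lambda>z. g z + ereal (episcale (1 / L) \<phi>
      (z - (x k - (1 / L) *\<^sub>R conj_gradient \<phi> (gradient f (x k)))))) (\<lambda>_. True) (x (Suc k))" for k
    using assms(11) unfolding apg_iterates_def Let_def by blast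
  note decrease = objective_step_le_envelope[OF assms(5,6) step]
  have contraction: "objective f g (x (Suc k)) - ereal m
      \<le> ereal (1 - \<mu> / L) * (objective f g (x k) - ereal m)" for k
    using suboptimality_contraction[OF assms(4,13,14) Inf decrease] .
  have lower: "ereal m \<le> objective f g (x k)" for k
    unfolding Inf[symmetric] by (rule INF_lower) simp
  have "0 \<le> 1 - \<mu> / L" "1 - \<mu> / L < 1"
    using assms(4,12,13) by (auto simp: field_simps)
  then have "q_linearly_converges (\<lambda>k. objective f g (x k)) (ereal m) (1 - \<mu> / L)"
    using lower decrease(2) contraction by (rule q_linearly_convergesI)
  then show ?thesis
    using contraction unfolding Inf by blast
qed

end
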